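(* Let $(X,d)$ be an ultrametric space. Then the following statements are equivalent: (1) The space $(X,d)$ is complete. (2) The space $(\bar{\mathbf{B}}_X, d_H)$ is complete.
   Context: Metric spaces are nonempty. An ultrametric space is a metric space $(X,d)$ with $d(x,y)\le\max\{d(x,z),d(z,y)\}$ for all $x,y,z\in X$. For $c\in X$ and $r\ge 0$ the closed ball is $\bar B_r(c)=\{x\in X: d(c,x)\le r\}$ (so $\bar B_0(c)=\{c\}$). $\bar{\mathbf{B}}_X$ is the set of all closed balls $\bar B_r(c)$, $c\in X$, $r\ge 0$, regarded as subsets of $X$. The Hausdorff distance between nonempty closed bounded sets $A,B\subseteq X$ is $d_H(A,B)=\max\{\sup_{a\in A}\inf_{b\in B}d(a,b),\ \sup_{b\in B}\inf_{a\in A}d(a,b)\}$; $\bar{\mathbf{B}}_X$ is equipped with the metric $d_H$. *)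

theory Defs
  imports "HOL-Analysis.Analysis"
begin

locale Ultrametric_space = Metric_space +
  assumes nonempty: "M \<noteq> {}"
    and ultrametric: "\<lbrakk>x \<in> M; y \<in> M; z \<in> M\<rbrakk> \<Longrightarrow> d x y \<le> max (d x z) (d z y)"

context Metric_space
begin

definition closed_balls :: "'a set set" where
  "closed_balls = {mcball c r | c r. c \<in> M \<and> r \<ge> 0}"

definition closed_bounded_sets :: "'a set set" where
  "closed_bounded_sets = {A. A \<noteq> {} \<and> closedin mtopology A \<and> mbounded A}"

text \<open>The value 0 outside the intended domain is a dummy: the locale \<^locale>\<open>Metric_space\<close> requires
  nonnegativity and symmetry for all arguments of the type, not only on the carrier.\<close>

definition hausdorff_dist :: "'a set \<Rightarrow> 'a set \<Rightarrow> real" where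
  "hausdorff_dist A B =
    (if A \<in> closed_bounded_sets \<and> B \<in> closed_bounded_sets
     then max (SUP a\<in>A. INF b\<in>B. d a b) (SUP b\<in>B. INF a\<in>A. d a b)
     else 0)"

lemma closed_balls_subset: "closed_balls \<subseteq> closed_bounded_sets"
  by (auto simp: closed_balls_def closed_bounded_sets_def mbounded_mcball)

lemma INF_dist_le_iff:
  assumes "B \<noteq> {}"
  shows "(INF b\<in>B. d a b) \<le> c \<longleftrightarrow> (\<forall>e>0. \<exists>b\<in>B. d a b < c + e)"
proof -
  have bdd: "bdd_below (d a ` B)"
    by (rule bdd_belowI2[of _ 0]) simp
  have "(INF b\<in>B. d a b) \<le> c \<longleftrightarrow> (\<forall>e>0. (INF b\<in>B. d a b) < c + e)"
    by (meson field_le_epsilon less_add_same_cancel1 less_le_not_le linorder_not_less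
        order_le_less_trans)
  then show ?thesis
    using cINF_less_iff[OF assms bdd] by simp
qed

lemma SUP_INF_dist_le_iff:
  assumes A: "A \<noteq> {}" "mbounded A" and B: "B \<noteq> {}" "mbounded B"
  shows "(SUP a\<in>A. INF b\<in>B. d a b) \<le> c \<longleftrightarrow> (\<forall>a\<in>A. \<forall>e>0. \<exists>b\<in>B. d a b < c + e)"
proof -
  obtain b0 where b0: "b0 \<in> B" using B by blast
  obtain K where K: "\<And>x y. \<lbrakk>x \<in> A \<union> B; y \<in> A \<union> B\<rbrakk> \<Longrightarrow> d x y \<le> K"
    using mbounded_Un[of A B] A B mbounded_alt[of "A \<union> B"] by blast
  have "bdd_above ((\<lambda>a. INF b\<in>B. d a b) ` A)"
  proof (rule bdd_aboveI2[of _ _ K])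
    fix a assume "a \<in> A"
    then show "(INF b\<in>B. d a b) \<le> K"
      using K[of a b0] b0 by (auto simp: INF_dist_le_iff[OF B(1)] intro!: bexI[of _ b0])
  qed
  then show ?thesis
    by (simp add: cSUP_le_iff[OF A(1)] INF_dist_le_iff[OF B(1)])
qed

lemma hausdorff_dist_le_iff:
  assumes "A \<in> closed_bounded_sets" "B \<in> closed_bounded_sets"
  shows "hausdorff_dist A B \<le> c \<longleftrightarrow>
    (\<forall>e>0. (\<forall>a\<in>A. \<exists>b\<in>B. d a b < c + e) \<and> (\<forall>b\<in>B. \<exists>a\<in>A. d a b < c + e))"
proof -
  have "A \<noteq> {}" "mbounded A" "B \<noteq> {}" "mbounded B"
    using assms by (auto simp: closed_bounded_sets_def)
  then have "(SUP a\<in>A. INF b\<in>B. d a b) \<le> c \<longleftrightarrow> (\<forall>a\<in>A. \<forall>e>0. \<exists>b\<in>B. d a b < c + e)"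
    "(SUP b\<in>B. INF a\<in>A. d a b) \<le> c \<longleftrightarrow> (\<forall>b\<in>B. \<forall>e>0. \<exists>a\<in>A. d a b < c + e)"
    using SUP_INF_dist_le_iff[of A B c] SUP_INF_dist_le_iff[of B A c] by (simp_all add: commute)
  then show ?thesis
    using assms by (simp add: hausdorff_dist_def) blast
qed

lemma hausdorff_dist_commute: "hausdorff_dist A B = hausdorff_dist B A"
  by (simp add: hausdorff_dist_def commute max.commute)

lemma hausdorff_dist_nonneg: "0 \<le> hausdorff_dist A B"
proof (cases "A \<in> closed_bounded_sets \<and> B \<in> closed_bounded_sets")
  case True
  then obtain a where a: "a \<in> A" by (auto simp: closed_bounded_sets_def)
  let ?h = "hausdorff_dist A B"
  show ?thesis
  proof (rule field_le_epsilon)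
    fix e :: real assume "e > 0"
    then obtain b where "d a b < ?h + e"
      using True a hausdorff_dist_le_iff[of A B ?h] by blast
    then show "0 \<le> ?h + e" using nonneg[of a b] by linarith
  qed
qed (auto simp: hausdorff_dist_def)

lemma hausdorff_dist_zero_imp_subset:
  assumes A: "A \<in> closed_bounded_sets" and B: "B \<in> closed_bounded_sets"
    and 0: "hausdorff_dist A B = 0"
  shows "A \<subseteq> B"
proof
  fix a assume a: "a \<in> A"
  have cl: "closedin mtopology B" and "A \<subseteq> M"
    using A B by (auto simp: closed_bounded_sets_def dest: mbounded_subset_mspace)
  have near: "\<exists>b\<in>B. d a b < e" if "e > 0" for e
    using hausdorff_dist_le_iff[OF A B, of 0] 0 that a by simp
  show "a \<in> B"
  proof (rule ccontr)
    assume "a \<notin> B"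
    then obtain r where "r > 0" "disjnt B (mball a r)"
      using cl a \<open>A \<subseteq> M\<close> by (auto simp: closedin_metric)
    moreover obtain b where "b \<in> B" "d a b < r" using near \<open>r > 0\<close> by blast
    moreover have "b \<in> M" using \<open>b \<in> B\<close> B mbounded_subset_mspace
      by (auto simp: closed_bounded_sets_def)
    ultimately show False using a \<open>A \<subseteq> M\<close> by (auto simp: disjnt_iff)
  qed
qed

lemma hausdorff_dist_triangle:
  assumes A: "A \<in> closed_bounded_sets" and B: "B \<in> closed_bounded_sets"
    and C: "C \<in> closed_bounded_sets"
  shows "hausdorff_dist A C \<le> hausdorff_dist A B + hausdorff_dist B C"
proof -
  let ?p = "hausdorff_dist A B" and ?q = "hausdorff_dist B C"
  have M: "A \<subseteq> M" "B \<subseteq> M" "C \<subseteq> M"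
    using A B C mbounded_subset_mspace by (auto simp: closed_bounded_sets_def)
  have *: "(\<forall>a\<in>A. \<exists>c\<in>C. d a c < ?p + ?q + e) \<and> (\<forall>c\<in>C. \<exists>a\<in>A. d a c < ?p + ?q + e)"
    if "e > 0" for e
  proof -
    have e: "e/2 > 0" using that by simp
    have AB: "(\<forall>a\<in>A. \<exists>b\<in>B. d a b < ?p + e/2) \<and> (\<forall>b\<in>B. \<exists>a\<in>A. d a b < ?p + e/2)"
      using hausdorff_dist_le_iff[OF A B, of ?p] e by blast
    have BC: "(\<forall>b\<in>B. \<exists>c\<in>C. d b c < ?q + e/2) \<and> (\<forall>c\<in>C. \<exists>b\<in>B. d b c < ?q + e/2)"
      using hausdorff_dist_le_iff[OF B C, of ?q] e by blast
    have tri: "d a c < ?p + ?q + e"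
      if "a \<in> A" "b \<in> B" "c \<in> C" "d a b < ?p + e/2" "d b c < ?q + e/2" for a b c
      using triangle[of a b c] that M by (auto simp: subset_iff)
    show ?thesis using AB BC tri by meson
  qed
  then show ?thesis
    by (simp add: hausdorff_dist_le_iff[OF A C])
qed

lemma Metric_space_hausdorff: "Metric_space closed_bounded_sets hausdorff_dist"
proof
  fix A B assume AB: "A \<in> closed_bounded_sets" "B \<in> closed_bounded_sets"
  have "d a a = 0" if "a \<in> A" for a
    using AB(1) mbounded_subset_mspace[of A] that by (auto simp: closed_bounded_sets_def)
  then have "hausdorff_dist A A \<le> 0"
    unfolding hausdorff_dist_le_iff[OF AB(1) AB(1)] by (metis add_0)
  then show "hausdorff_dist A B = 0 \<longleftrightarrow> A = B"
    using hausdorff_dist_zero_imp_subset[OF AB] hausdorff_dist_zero_imp_subset[OF AB(2,1)]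
      hausdorff_dist_commute[of A B] hausdorff_dist_nonneg[of A A] by auto
qed (auto intro: hausdorff_dist_nonneg hausdorff_dist_commute hausdorff_dist_triangle)

lemma Metric_space_closed_balls: "Metric_space closed_balls hausdorff_dist"
  using Metric_space.subspace[OF Metric_space_hausdorff closed_balls_subset] .

end

end

theory Submission
  imports Defs
begin

text \<open>
  Singletons are closed balls, and \<open>x \<mapsto> {x}\<close> is an isometry, so a Cauchy sequence of points gives
  a Cauchy sequence of balls; every point of the limit ball is then a limit of the points.

  Conversely, in an ultrametric space distinct balls \<open>A\<close>, \<open>B\<close> satisfy
  \<open>d a b \<le> hausdorff_dist A B\<close> for all \<open>a \<in> A\<close>, \<open>b \<in> B\<close>. Hence any choice function on balls is
  1-Lipschitz, and maps a Cauchy sequence of balls to a Cauchy sequence of points, with limit \<open>x\<close>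
  say. If the sequence of balls is not eventually constant, every ball in it has a later ball
  different from it, which forces the balls to shrink to \<open>{x}\<close>.
\<close>

context Metric_space
begin

lemma singleton_in_closed_balls:
  assumes "x \<in> M"
  shows "{x} \<in> closed_balls"
proof -
  have "{x} = mcball x 0"
    using assms by (auto simp: mcball_def) (metis nonneg order_antisym zero)
  then show ?thesis
    using assms by (auto simp: closed_balls_def)
qed

text \<open>Only the condition on points of \<open>A\<close> matters: \<open>A\<close> is nonempty,
  so a bound on all \<open>d a x\<close> also puts some point of \<open>A\<close> near
  \<open>x\<close>.\<close>

lemma hausdorff_dist_singleton_le_iff:
  assumes "A \<in> closed_bounded_sets" "x \<in> M"
  shows "hausdorff_dist A {x} \<le> c \<longleftrightarrow> (\<forall>a\<in>A. d a x \<le> c)"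
proof -
  have x: "{x} \<in> closed_bounded_sets"
    using singleton_in_closed_balls[OF assms(2)] closed_balls_subset by blast
  have "A \<noteq> {}"
    using assms(1) by (simp add: closed_bounded_sets_def)
  then have "hausdorff_dist A {x} \<le> c \<longleftrightarrow> (\<forall>e>0. \<forall>a\<in>A. d a x < c + e)"
    by (auto simp: hausdorff_dist_le_iff[OF assms(1) x])
  also have "\<dots> \<longleftrightarrow> (\<forall>a\<in>A. d a x \<le> c)"
    by (meson field_le_epsilon less_add_same_cancel1 less_imp_le order_le_less_trans)
  finally show ?thesis .
qed

lemma mcomplete_if_mcomplete_closed_balls:
  assumes "Metric_space.mcomplete closed_balls hausdorff_dist"
  shows mcomplete
  unfolding mcomplete_def
proof (intro allI impI)
  interpret H: Metric_space closed_balls hausdorff_dist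
    by (rule Metric_space_closed_balls)
  fix \<sigma> assume \<sigma>: "MCauchy \<sigma>"
  then have M: "\<sigma> n \<in> M" for n
    by (auto simp: MCauchy_def)
  have balls: "{\<sigma> n} \<in> closed_balls" "{\<sigma> n} \<in> closed_bounded_sets" for n
    using singleton_in_closed_balls[OF M] closed_balls_subset by auto
  have le: "hausdorff_dist {\<sigma> m} {\<sigma> n} \<le> d (\<sigma> m) (\<sigma> n)" for m n
    by (simp add: hausdorff_dist_singleton_le_iff balls M)
  have "H.MCauchy (\<lambda>n. {\<sigma> n})"
    using \<sigma> balls le unfolding MCauchy_def H.MCauchy_def
    by (meson image_subsetI order_le_less_trans)
  then obtain B where B: "limitin H.mtopology (\<lambda>n. {\<sigma> n}) B sequentially"
    using assms unfolding H.mcomplete_def by blast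
  then have ball: "B \<in> closed_balls"
    by (rule H.limitin_mspace)
  then have cb: "B \<in> closed_bounded_sets"
    using closed_balls_subset by blast
  then obtain b where b: "b \<in> B"
    by (auto simp: closed_bounded_sets_def)
  have "b \<in> M"
    using b cb mbounded_subset_mspace by (auto simp: closed_bounded_sets_def)
  \<comment> \<open>With the distance itself as the bound, the singleton criterion controls every
    point of \<open>B\<close>, so an arbitrary \<open>b\<close> serves as the limit.\<close>
  have "d (\<sigma> n) b \<le> hausdorff_dist {\<sigma> n} B" for n
    using hausdorff_dist_singleton_le_iff[OF cb M, of n "hausdorff_dist B {\<sigma> n}"] b
    by (simp add: commute hausdorff_dist_commute)
  then have "limitin mtopology \<sigma> b sequentially"
    using B \<open>b \<in> M\<close> M unfolding limit_metric_sequentially H.limit_metric_sequentially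
    by (meson order_le_less_trans)
  then show "\<exists>x. limitin mtopology \<sigma> x sequentially" ..
qed

end

context Ultrametric_space
begin

text \<open>A point of \<open>B\<close> outside \<open>A\<close> is farther than the radius
  \<open>s\<close> from the centre of \<open>A\<close>, so the Hausdorff distance is at least
  \<open>s\<close>, which bounds the diameter of \<open>A\<close>. Going from \<open>b\<close> to a
  nearby \<open>z\<close> in \<open>A\<close>, and on to any \<open>a\<close>, then costs no
  more.\<close>

lemma dist_le_hausdorff_dist_if_not_subset:
  assumes A: "A \<in> closed_balls" and B: "B \<in> closed_balls" and "\<not> B \<subseteq> A"
    and a: "a \<in> A" and b: "b \<in> B"
  shows "d a b \<le> hausdorff_dist A B"
proof (rule field_le_epsilon)
  let ?h = "hausdorff_dist A B"
  fix e :: real assume e: "e > 0"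
  have near: "\<exists>a\<in>A. d a y < ?h + e" if "y \<in> B" for y
    using hausdorff_dist_le_iff[of A B ?h] A B closed_balls_subset e that by blast
  obtain c s where c: "c \<in> M" and As: "A = mcball c s"
    using A by (auto simp: closed_balls_def)
  have BM: "B \<subseteq> M"
    using B by (auto simp: closed_balls_def)
  have diam: "d x y \<le> s" if "x \<in> A" "y \<in> A" for x y
    using ultrametric[of x y c] that c by (auto simp: As commute)
  obtain b' where b': "b' \<in> B" "b' \<notin> A"
    using \<open>\<not> B \<subseteq> A\<close> by blast
  then obtain a' where a': "a' \<in> A" "d a' b' < ?h + e"
    using near by blast
  have "s < d c b'"
    using b' BM c by (auto simp: As)
  \<comment> \<open>Since \<open>s < d c b'\<close>, the maximum cannot be \<open>s\<close>, so
    \<open>s < d a' b'\<close>.\<close>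
  also have "d c b' \<le> max s (d a' b')"
    using ultrametric[of c b' a'] a' b' BM c by (auto simp: As)
  finally have "s < ?h + e"
    using a' by linarith
  moreover obtain z where "z \<in> A" "d z b < ?h + e"
    using near b by blast
  moreover have "d a b \<le> max (d a z) (d z b)"
    using ultrametric[of a b z] a b BM \<open>z \<in> A\<close> by (auto simp: As)
  ultimately show "d a b \<le> ?h + e"
    using diam[OF a \<open>z \<in> A\<close>] by linarith
qed

text \<open>Of two distinct sets one is not contained in the other; symmetry covers both
  cases.\<close>

lemma dist_le_hausdorff_dist:
  assumes "A \<in> closed_balls" "B \<in> closed_balls" "A \<noteq> B" "a \<in> A" "b \<in> B"
  shows "d a b \<le> hausdorff_dist A B"
proof (cases "B \<subseteq> A")
  case False
  then show ?thesis
    using assms dist_le_hausdorff_dist_if_not_subset by blast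
next
  case True
  then have "\<not> A \<subseteq> B"
    using assms(3) by blast
  then show ?thesis
    using assms dist_le_hausdorff_dist_if_not_subset[of B A b a]
    by (simp add: commute hausdorff_dist_commute)
qed

lemma mcomplete_closed_balls_if_mcomplete:
  assumes mcomplete
  shows "Metric_space.mcomplete closed_balls hausdorff_dist"
proof -
  interpret H: Metric_space closed_balls hausdorff_dist
    by (rule Metric_space_closed_balls)
  define f :: "'a set \<Rightarrow> 'a" where "f = (\<lambda>A. SOME x. x \<in> A)"
  have f: "f A \<in> A" if "A \<in> closed_balls" for A
    using that closed_balls_subset some_in_eq[of A]
    by (auto simp: f_def closed_bounded_sets_def)
  have fM: "f A \<in> M" if "A \<in> closed_balls" for A
    using f[OF that] that by (auto simp: closed_balls_def)
  \<comment> \<open>For \<open>A = B\<close> both chosen points coincide, so both sides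
    vanish.\<close>
  have Lip: "d (f A) (f B) \<le> hausdorff_dist A B" if "A \<in> closed_balls" "B \<in> closed_balls" for A B
    using that f dist_le_hausdorff_dist[of A B] fM
    by (cases "A = B") auto
  show ?thesis
    unfolding H.mcomplete_def
  proof (intro allI impI)
    fix \<sigma> assume \<sigma>: "H.MCauchy \<sigma>"
    then have balls: "\<sigma> n \<in> closed_balls" for n
      by (auto simp: H.MCauchy_def)
    have "MCauchy (\<lambda>n. f (\<sigma> n))"
      using \<sigma> balls fM Lip unfolding MCauchy_def H.MCauchy_def
      by (meson image_subsetI order_le_less_trans)
    then obtain x where x: "limitin mtopology (\<lambda>n. f (\<sigma> n)) x sequentially"
      using assms unfolding mcomplete_def by blast
    then have "x \<in> M"
      by (rule limitin_mspace)
    show "\<exists>B. limitin H.mtopology \<sigma> B sequentially"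
    proof (cases "\<exists>N. \<forall>n\<ge>N. \<sigma> n = \<sigma> N")
      case True
      then obtain N where "\<forall>n\<ge>N. \<sigma> n = \<sigma> N" ..
      then have "limitin H.mtopology \<sigma> (\<sigma> N) sequentially"
        using balls unfolding H.limit_metric_sequentially by (metis H.mdist_zero)
      then show ?thesis ..
    next
      case False
      have "\<exists>N. \<forall>n\<ge>N. \<sigma> n \<in> closed_balls \<and> hausdorff_dist (\<sigma> n) {x} < e" if "e > 0" for e
      proof -
        \<comment> \<open>The ultrametric inequality takes a maximum, so the two errors do not add
          up; halving keeps the bound strict after the supremum over the ball.\<close>
        have e2: "e/2 > 0"
          using that by simp
        obtain N1 where N1: "\<And>m n. \<lbrakk>N1 \<le> m; N1 \<le> n\<rbrakk> \<Longrightarrow> hausdorff_dist (\<sigma> m) (\<sigma> n) < e/2"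
          using \<sigma> e2 unfolding H.MCauchy_def by blast
        obtain N2 where N2: "\<And>n. N2 \<le> n \<Longrightarrow> d (f (\<sigma> n)) x < e/2"
          using x e2 unfolding limit_metric_sequentially by blast
        have "hausdorff_dist (\<sigma> n) {x} \<le> e/2" if n: "n \<ge> max N1 N2" for n
        proof -
          obtain m where m: "m \<ge> n" "\<sigma> m \<noteq> \<sigma> n"
            using False by blast
          have "d a x \<le> e/2" if a: "a \<in> \<sigma> n" for a
          proof -
            \<comment> \<open>The point chosen in the different ball \<open>\<sigma> m\<close> links
              \<open>a\<close> to \<open>x\<close>: it is close to all of \<open>\<sigma> n\<close>,
              and to \<open>x\<close> because \<open>m\<close> is late.\<close>
            have "d a (f (\<sigma> m)) \<le> hausdorff_dist (\<sigma> n) (\<sigma> m)"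
              using dist_le_hausdorff_dist[of "\<sigma> n" "\<sigma> m"] m a balls f by metis
            moreover have "a \<in> M"
              using a balls[of n] by (auto simp: closed_balls_def)
            ultimately show ?thesis
              using ultrametric[of a x "f (\<sigma> m)"] \<open>x \<in> M\<close> fM[OF balls[of m]]
                N1[of n m] N2[of m] m(1) n by auto
          qed
          then show ?thesis
            using hausdorff_dist_singleton_le_iff[of "\<sigma> n" x "e/2"] balls closed_balls_subset
              \<open>x \<in> M\<close> by blast
        qed
        then show ?thesis
          using balls that by (intro exI[of _ "max N1 N2"]) fastforce
      qed
      then have "limitin H.mtopology \<sigma> {x} sequentially"
        unfolding H.limit_metric_sequentially
        using singleton_in_closed_balls[OF \<open>x \<in> M\<close>] by blast
      then show ?thesis ..
    qed
  qed
qed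

end

theorem theorem5p10:
  fixes X :: "'a set" and d :: "'a \<Rightarrow> 'a \<Rightarrow> real"
  assumes "Ultrametric_space X d"
  shows "Metric_space.mcomplete X d \<longleftrightarrow>
    Metric_space.mcomplete (Metric_space.closed_balls X d) (Metric_space.hausdorff_dist X d)"
proof -
  interpret Ultrametric_space X d
    by (rule assms)
  show ?thesis
    using mcomplete_if_mcomplete_closed_balls mcomplete_closed_balls_if_mcomplete by blast
qed

end
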